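(* Two LPOD programs $P$ and $Q$ are strongly equivalent if and only if their LPMLN translations $\tau^\times(P)$ and $\tau^\times(Q)$ are semi-strongly equivalent under the soft stable model semantics, i.e. $\mathrm{SSM}(\tau^\times(P)\cup R)=\mathrm{SSM}(\tau^\times(Q)\cup R)$ for every LPMLN program $R$.
   Context: A literal is an atom $a$ or its classical negation $\neg a$. An ASP rule $r$ has the form $l_1\vee\cdots\vee l_k\leftarrow l_{k+1},\dots,l_m,\ not\ l_{m+1},\dots,\ not\ l_n$ with literals $l_i$; $h(r)$, $b^+(r)$, $b^-(r)$ are the head, positive body and negative body literal sets. An interpretation is a set of literals not containing both $a$ and $\neg a$ for any atom $a$. $I\models r$ iff ($b^+(r)\subseteq I$ and $b^-(r)\cap I=\emptyset$) implies $h(r)\cap I\neq\emptyset$. For an ASP program $\Pi$ (finite set of ground rules) the GL-reduct is $\Pi^I=\{h(r)\leftarrow b^+(r) : r\in\Pi,\ b^-(r)\cap I=\emptyset\}$, and $I$ is a stable model of $\Pi$ iff $I\models\Pi^I$ and no proper subset of $I$ satisfies $\Pi^I$. An LPOD program $P$ is a finite set consisting of ASP rules (the regular part $P^r$) and ordered disjunction rules $r$ of the form $h_1\times\cdots\times h_n\leftarrow b^+(r),\ not\ b^-(r)$ with pairwise distinct literals $h_i$ (the set $P^o$); $o(r)=n$. The $i$-th option $r^i$ ($1\le i\le o(r)$) is the ASP rule $h_i\leftarrow b^+(r),\ not\ b^-(r),\ not\ h_1,\dots,not\ h_{i-1}$. A split program of $P$ is obtained by replacing each rule of $P^o$ by one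 of its options; a candidate stable model of $P$ is a stable model of some split program; $\mathrm{CSM}(P)$ is their set. LPOD programs $P,Q$ are strongly equivalent iff $\mathrm{CSM}(P\cup R)=\mathrm{CSM}(Q\cup R)$ for every LPOD program $R$. An LPMLN program is a finite set of weighted rules $w:r$, $r$ an ASP rule, $w$ a real number (soft) or the symbol $\alpha$ (hard); $\overline{P}=\{r: w:r\in P\}$, $P^h$ the hard rules, $P_I=\{w:r\in P: I\models r\}$; $I$ is a stable model of an LPMLN program $P$ iff it is a stable model of $\overline{P_I}$; a soft stable model is a stable model satisfying all hard rules; $\mathrm{SSM}(P)$ is their set. The translation is $\tau^\times(P)=\{\alpha:r\mid r\in P^r\}\cup\{1:r^k\mid r\in P^o,\ 1\le k\le o(r)\}\cup\{\alpha:\ \leftarrow b^+(r),not\ b^-(r),not\ h_1,\dots,not\ h_{o(r)}\mid r\in P^o\}$. *)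

theory Defs
  imports Complex_Main "HOL-Library.FSet"
begin

section \<open>Answer set programs with classical negation\<close>

datatype 'a literal = Pos 'a | Neg 'a

text \<open>Head and bodies are finite sets of literals; an empty head gives a constraint.\<close>

datatype 'a asp_rule =
  Rule (head: "'a literal fset") (pos_body: "'a literal fset") (neg_body: "'a literal fset")

definition interpretation_set :: "'a literal set \<Rightarrow> bool" where
  "interpretation_set I \<longleftrightarrow> (\<forall>a. \<not> (Pos a \<in> I \<and> Neg a \<in> I))"

definition sat :: "'a literal set \<Rightarrow> 'a asp_rule \<Rightarrow> bool" where
  "sat I r \<longleftrightarrow>
     (fset (pos_body r) \<subseteq> I \<and> fset (neg_body r) \<inter> I = {} \<longrightarrow> fset (head r) \<inter> I \<noteq> {})"

definition models :: "'a literal set \<Rightarrow> 'a asp_rule set \<Rightarrow> bool" where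
  "models I \<Pi> \<longleftrightarrow> (\<forall>r\<in>\<Pi>. sat I r)"

definition reduct :: "'a asp_rule set \<Rightarrow> 'a literal set \<Rightarrow> 'a asp_rule set" where
  "reduct \<Pi> I = {Rule (head r) (pos_body r) {||} | r. r \<in> \<Pi> \<and> fset (neg_body r) \<inter> I = {}}"

definition stable_model :: "'a asp_rule set \<Rightarrow> 'a literal set \<Rightarrow> bool" where
  "stable_model \<Pi> I \<longleftrightarrow>
     interpretation_set I \<and> models I (reduct \<Pi> I) \<and> (\<forall>J. J \<subset> I \<longrightarrow> \<not> models J (reduct \<Pi> I))"

section \<open>Logic programs with ordered disjunction (LPOD)\<close>

datatype 'a od_rule =
  ODRule (od_heads: "'a literal list") (od_pos: "'a literal fset") (od_neg: "'a literal fset")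

datatype 'a lpod_rule = Regular "'a asp_rule" | Ordered "'a od_rule"

definition regular_part :: "'a lpod_rule set \<Rightarrow> 'a asp_rule set" where
  "regular_part P = {r. Regular r \<in> P}"

definition ordered_part :: "'a lpod_rule set \<Rightarrow> 'a od_rule set" where
  "ordered_part P = {r. Ordered r \<in> P}"

definition od_size :: "'a od_rule \<Rightarrow> nat" where
  "od_size r = length (od_heads r)"

text \<open>An ordered disjunction has at least one disjunct, and its disjuncts are pairwise distinct.\<close>

definition lpod_program :: "'a lpod_rule set \<Rightarrow> bool" where
  "lpod_program P \<longleftrightarrow>
     finite P \<and> (\<forall>r\<in>ordered_part P. od_size r \<ge> 1 \<and> distinct (od_heads r))"

text \<open>The \<open>i\<close>-th option is meaningful for \<open>1 \<le> i \<le> od_size r\<close>; options are counted from 1,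
  list positions from 0.\<close>

definition od_option :: "'a od_rule \<Rightarrow> nat \<Rightarrow> 'a asp_rule" where
  "od_option r i =
     Rule {|od_heads r ! (i - 1)|} (od_pos r)
          (od_neg r |\<union>| fset_of_list (take (i - 1) (od_heads r)))"

definition split_program :: "'a lpod_rule set \<Rightarrow> 'a asp_rule set \<Rightarrow> bool" where
  "split_program P \<Pi> \<longleftrightarrow>
     (\<exists>c. (\<forall>r\<in>ordered_part P. 1 \<le> c r \<and> c r \<le> od_size r) \<and>
          \<Pi> = regular_part P \<union> {od_option r (c r) | r. r \<in> ordered_part P})"

definition CSM :: "'a lpod_rule set \<Rightarrow> 'a literal set set" where
  "CSM P = {I. \<exists>\<Pi>. split_program P \<Pi> \<and> stable_model \<Pi> I}"

definition lpod_strongly_equivalent :: "'a lpod_rule set \<Rightarrow> 'a lpod_rule set \<Rightarrow> bool" where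
  "lpod_strongly_equivalent P Q \<longleftrightarrow>
     (\<forall>R. lpod_program R \<longrightarrow> CSM (P \<union> R) = CSM (Q \<union> R))"

section \<open>LPMLN programs\<close>

text \<open>\<open>Hard\<close> is the symbolic weight \<open>\<alpha>\<close>.\<close>

datatype weight = Soft real | Hard

type_synonym 'a lpmln = "(weight \<times> 'a asp_rule) set"

definition lpmln_program :: "'a lpmln \<Rightarrow> bool" where
  "lpmln_program P \<longleftrightarrow> finite P"

definition unweighted :: "'a lpmln \<Rightarrow> 'a asp_rule set" where
  "unweighted P = {r. \<exists>w. (w, r) \<in> P}"

definition hard_part :: "'a lpmln \<Rightarrow> 'a lpmln" where
  "hard_part P = {(w, r) \<in> P. w = Hard}"

definition satisfied_part :: "'a lpmln \<Rightarrow> 'a literal set \<Rightarrow> 'a lpmln" where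
  "satisfied_part P I = {(w, r) \<in> P. sat I r}"

definition lpmln_stable_model :: "'a lpmln \<Rightarrow> 'a literal set \<Rightarrow> bool" where
  "lpmln_stable_model P I \<longleftrightarrow> stable_model (unweighted (satisfied_part P I)) I"

definition SSM :: "'a lpmln \<Rightarrow> 'a literal set set" where
  "SSM P = {I. lpmln_stable_model P I \<and> models I (unweighted (hard_part P))}"

definition soft_semi_strongly_equivalent :: "'a lpmln \<Rightarrow> 'a lpmln \<Rightarrow> bool" where
  "soft_semi_strongly_equivalent P Q \<longleftrightarrow>
     (\<forall>R. lpmln_program R \<longrightarrow> SSM (P \<union> R) = SSM (Q \<union> R))"

section \<open>The translation of LPOD programs into LPMLN programs\<close>

definition od_constraint :: "'a od_rule \<Rightarrow> 'a asp_rule" where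
  "od_constraint r = Rule {||} (od_pos r) (od_neg r |\<union>| fset_of_list (od_heads r))"

definition tau_times :: "'a lpod_rule set \<Rightarrow> 'a lpmln" where
  "tau_times P =
     {(Hard, r) | r. r \<in> regular_part P} \<union>
     {(Soft 1, od_option r k) | r k. r \<in> ordered_part P \<and> 1 \<le> k \<and> k \<le> od_size r} \<union>
     {(Hard, od_constraint r) | r. r \<in> ordered_part P}"

end

theory Submission
  imports Defs
begin

text \<open>
  The candidate stable models of an LPOD program are exactly the soft stable models of its
  translation: when \<open>I\<close> satisfies the body of an ordered rule, the only option that is satisfied
  by \<open>I\<close> and not removed from the reduct is the one whose head is the first disjunct in \<open>I\<close>.
  Hence semi-strong equivalence of the translations implies strong equivalence. Conversely, to test
  whether \<open>I\<close> is a soft stable model of the translation extended by an LPMLN program \<open>R\<close>, one may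
  replace \<open>R\<close> by the rules of \<open>R\<close> that \<open>I\<close> satisfies, taken as regular LPOD rules.
\<close>

section \<open>Satisfaction of the reduct, rule by rule\<close>

text \<open>A rule deleted by the reduct counts as satisfied, so minimality can be compared between
  programs one rule at a time.\<close>

definition reduct_sat :: "'a literal set \<Rightarrow> 'a literal set \<Rightarrow> 'a asp_rule \<Rightarrow> bool" where
  "reduct_sat I J r \<longleftrightarrow>
     (fset (neg_body r) \<inter> I = {} \<longrightarrow> fset (pos_body r) \<subseteq> J \<longrightarrow> fset (head r) \<inter> J \<noteq> {})"

lemma models_reduct_iff: "models J (reduct \<Pi> I) \<longleftrightarrow> (\<forall>r\<in>\<Pi>. reduct_sat I J r)"
  unfolding models_def reduct_def reduct_sat_def sat_def by fastforce

lemma reduct_sat_self: "reduct_sat I I r \<longleftrightarrow> sat I r"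
  unfolding reduct_sat_def sat_def by blast

lemma stable_model_iff:
  "stable_model \<Pi> I \<longleftrightarrow>
     interpretation_set I \<and> models I \<Pi> \<and> (\<forall>J. J \<subset> I \<longrightarrow> (\<exists>r\<in>\<Pi>. \<not> reduct_sat I J r))"
  unfolding stable_model_def models_reduct_iff by (simp add: models_def reduct_sat_self)

text \<open>Every proper subset of \<open>I\<close> already violates what the reduct keeps of some
  rule of \<open>\<Pi>\<close>, and that rule is still present in \<open>\<Pi>'\<close>.\<close>

lemma stable_model_superset:
  assumes "stable_model \<Pi> I" "\<Pi> \<subseteq> \<Pi>'" "models I \<Pi>'"
  shows "stable_model \<Pi>' I"
  using assms unfolding stable_model_iff by blast

section \<open>Options of a single ordered rule\<close>

text \<open>If the body of the constraint held in \<open>I\<close>, no disjunct would lie in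
  \<open>I\<close>, yet the body of option \<open>k\<close> would hold and force its head, a
  disjunct, into \<open>I\<close>.\<close>

lemma sat_od_option_imp_constraint:
  assumes "sat I (od_option r k)" "1 \<le> k" "k \<le> od_size r"
  shows "sat I (od_constraint r)"
proof -
  have "od_heads r ! (k - 1) \<in> set (od_heads r)"
    using assms by (auto simp: od_size_def intro: nth_mem)
  moreover have "set (take (k - 1) (od_heads r)) \<subseteq> set (od_heads r)"
    by (rule set_take_subset)
  ultimately show ?thesis
    using assms(1) unfolding sat_def od_option_def od_constraint_def
    by (auto simp: fset_of_list.rep_eq)
qed

text \<open>One option stands for all options that \<open>I\<close> satisfies. Since
  \<open>c\<close> is chosen before \<open>J\<close> and \<open>k\<close>, a single split program
  serves against all \<open>J\<close> at once.\<close>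

lemma ex_od_option_reduct:
  assumes constr: "sat I (od_constraint r)" and size: "1 \<le> od_size r"
  shows "\<exists>c. 1 \<le> c \<and> c \<le> od_size r \<and> sat I (od_option r c) \<and>
           (\<forall>J k. J \<subseteq> I \<longrightarrow> 1 \<le> k \<longrightarrow> k \<le> od_size r \<longrightarrow> sat I (od_option r k) \<longrightarrow>
              reduct_sat I J (od_option r c) \<longrightarrow> reduct_sat I J (od_option r k))"
proof (cases "fset (od_pos r) \<subseteq> I \<and> fset (od_neg r) \<inter> I = {}")
  \<comment> \<open>Option 1 is an arbitrary choice: each option is either deleted from the reduct
    or has a positive body that fails in \<open>I\<close>, hence in every
    \<open>J \<subseteq> I\<close>.\<close>
  case False
  then show ?thesis
    using size unfolding sat_def reduct_sat_def od_option_def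
    by (intro exI[of _ 1]) auto
next
  case True
  let ?h = "od_heads r"
  have "\<exists>i. i < length ?h \<and> ?h ! i \<in> I"
    using constr True unfolding sat_def od_constraint_def
    by (auto simp: fset_of_list.rep_eq in_set_conv_nth)
  then obtain m where m: "m < length ?h" "?h ! m \<in> I"
    and least: "\<And>i. i < m \<Longrightarrow> i < length ?h \<Longrightarrow> ?h ! i \<notin> I"
    using exists_least_iff[of "\<lambda>i. i < length ?h \<and> ?h ! i \<in> I"] by blast
  have earlier: "set (take i ?h) \<inter> I = {}" if "i \<le> m" for i
    using that least m(1) by (auto simp: in_set_conv_nth)
  \<comment> \<open>The list position \<open>m\<close> counts from 0, so the option with head
    \<open>?h ! m\<close> has number \<open>Suc m\<close>.\<close>
  have "sat I (od_option r (Suc m))"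
    using m unfolding sat_def od_option_def by auto
  moreover have "reduct_sat I J (od_option r k)"
    if k: "1 \<le> k" "k \<le> od_size r" "sat I (od_option r k)"
      and J: "reduct_sat I J (od_option r (Suc m))" for J k
  proof (cases k "Suc m" rule: linorder_cases)
    case less
    \<comment> \<open>The body of option \<open>k\<close> holds in \<open>I\<close>, but its head
      precedes the first disjunct in \<open>I\<close>; so \<open>I\<close> violates it, against the
      assumption.\<close>
    then have "set (take (k - 1) ?h) \<inter> I = {}" "?h ! (k - 1) \<notin> I"
      using earlier[of "k - 1"] least[of "k - 1"] k m(1) by (auto simp: od_size_def)
    then show ?thesis
      using k(3) True unfolding sat_def od_option_def by (auto simp: fset_of_list.rep_eq)
  next
    case equal
    then show ?thesis using J by simp
  next
    case greater
    \<comment> \<open>Option \<open>k\<close> negates all earlier disjuncts, among them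
      \<open>?h ! m\<close>, which lies in \<open>I\<close>; so the reduct deletes it.\<close>
    then have "?h ! m \<in> set (take (k - 1) ?h)"
      using m(1) by (auto simp: in_set_conv_nth intro!: exI[of _ m])
    then show ?thesis
      using m(2) unfolding reduct_sat_def od_option_def by (auto simp: fset_of_list.rep_eq)
  qed
  ultimately show ?thesis
    using m(1) by (intro exI[of _ "Suc m"]) (auto simp: od_size_def)
qed

section \<open>Decomposition of programs and their translations\<close>

lemma unweighted_Un: "unweighted (P \<union> Q) = unweighted P \<union> unweighted Q"
  unfolding unweighted_def by blast

lemma satisfied_part_Un: "satisfied_part (P \<union> Q) I = satisfied_part P I \<union> satisfied_part Q I"
  unfolding satisfied_part_def by blast

lemma hard_part_Un: "hard_part (P \<union> Q) = hard_part P \<union> hard_part Q"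
  unfolding hard_part_def by blast

lemma models_Un: "models I (\<Pi> \<union> \<Pi>') \<longleftrightarrow> models I \<Pi> \<and> models I \<Pi>'"
  unfolding models_def by blast

lemma tau_times_Un: "tau_times (P \<union> Q) = tau_times P \<union> tau_times Q"
  unfolding tau_times_def regular_part_def ordered_part_def by blast

lemma tau_times_Regular: "tau_times (Regular ` \<Pi>) = {Hard} \<times> \<Pi>"
  unfolding tau_times_def regular_part_def ordered_part_def by auto

lemma lpod_program_Un: "lpod_program P \<Longrightarrow> lpod_program Q \<Longrightarrow> lpod_program (P \<union> Q)"
  unfolding lpod_program_def ordered_part_def by auto

lemma lpod_program_Regular: "finite \<Pi> \<Longrightarrow> lpod_program (Regular ` \<Pi>)"
  unfolding lpod_program_def ordered_part_def by auto

lemma models_hard_tau_times: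
  "models I (unweighted (hard_part (tau_times P))) \<longleftrightarrow>
     models I (regular_part P) \<and> (\<forall>r\<in>ordered_part P. sat I (od_constraint r))"
  unfolding models_def unweighted_def hard_part_def tau_times_def by auto

lemma models_satisfied_part: "models I (unweighted (satisfied_part P I))"
  unfolding models_def unweighted_def satisfied_part_def by blast

lemma unweighted_satisfied_tau_times:
  "unweighted (satisfied_part (tau_times P) I) =
     {r \<in> regular_part P. sat I r} \<union>
     {od_option r k | r k. r \<in> ordered_part P \<and> 1 \<le> k \<and> k \<le> od_size r \<and> sat I (od_option r k)} \<union>
     {od_constraint r | r. r \<in> ordered_part P \<and> sat I (od_constraint r)}"
  unfolding unweighted_def satisfied_part_def tau_times_def by auto

section \<open>Candidate stable models as soft stable models\<close>

text \<open>The rules of the split program hold in \<open>I\<close>, so they lie in the satisfied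
  part of the translation; whatever else lies there also holds in \<open>I\<close> and preserves
  stability.\<close>

lemma CSM_subset_SSM: "CSM P \<subseteq> SSM (tau_times P)"
proof
  fix I assume "I \<in> CSM P"
  then obtain c where c: "\<forall>r\<in>ordered_part P. 1 \<le> c r \<and> c r \<le> od_size r"
    and st: "stable_model (regular_part P \<union> {od_option r (c r) | r. r \<in> ordered_part P}) I"
      (is "stable_model ?\<Pi> I")
    unfolding CSM_def split_program_def by blast
  have mod: "models I ?\<Pi>" using st unfolding stable_model_iff by blast
  then have sub: "?\<Pi> \<subseteq> unweighted (satisfied_part (tau_times P) I)"
    using c unfolding unweighted_satisfied_tau_times models_def by blast
  have "sat I (od_constraint r)" if "r \<in> ordered_part P" for r
    using mod c that by (intro sat_od_option_imp_constraint[of I r "c r"]) (auto simp: models_def)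
  then have "models I (unweighted (hard_part (tau_times P)))"
    using mod unfolding models_hard_tau_times models_Un by blast
  then show "I \<in> SSM (tau_times P)"
    using stable_model_superset[OF st sub models_satisfied_part]
    unfolding SSM_def lpmln_stable_model_def by blast
qed

text \<open>The split program takes the options given by \<open>ex_od_option_reduct\<close>: a
  proper subset of \<open>I\<close> satisfying its reduct would also satisfy that of the whole
  satisfied part.\<close>

lemma SSM_subset_CSM:
  assumes "lpod_program P"
  shows "SSM (tau_times P) \<subseteq> CSM P"
proof
  fix I assume "I \<in> SSM (tau_times P)"
  then have st: "stable_model (unweighted (satisfied_part (tau_times P) I)) I"
    and reg: "models I (regular_part P)"
    and constr: "\<forall>r\<in>ordered_part P. sat I (od_constraint r)"
    unfolding SSM_def lpmln_stable_model_def using models_hard_tau_times by auto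
  have "\<forall>r\<in>ordered_part P. 1 \<le> od_size r"
    using assms unfolding lpod_program_def by blast
  with constr ex_od_option_reduct obtain c
    where c: "\<forall>r\<in>ordered_part P. 1 \<le> c r \<and> c r \<le> od_size r"
      and c_sat: "\<forall>r\<in>ordered_part P. sat I (od_option r (c r))"
      and c_red: "\<And>r J k. r \<in> ordered_part P \<Longrightarrow> J \<subseteq> I \<Longrightarrow> 1 \<le> k \<Longrightarrow> k \<le> od_size r \<Longrightarrow>
        sat I (od_option r k) \<Longrightarrow> reduct_sat I J (od_option r (c r)) \<Longrightarrow>
        reduct_sat I J (od_option r k)"
    by metis
  define \<Pi> where "\<Pi> = regular_part P \<union> {od_option r (c r) | r. r \<in> ordered_part P}"
  have "models I \<Pi>"
    using reg c_sat unfolding \<Pi>_def models_def by blast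
  moreover have "\<exists>r\<in>\<Pi>. \<not> reduct_sat I J r" if J: "J \<subset> I" for J
  proof (rule ccontr)
    assume "\<not> ?thesis"
    then have all: "\<forall>r\<in>\<Pi>. reduct_sat I J r" by blast
    have "reduct_sat I J r" if "r \<in> unweighted (satisfied_part (tau_times P) I)" for r
      using that unfolding unweighted_satisfied_tau_times
    proof (elim UnE)
      assume "r \<in> {r \<in> regular_part P. sat I r}"
      then show ?thesis using all unfolding \<Pi>_def by blast
    next
      assume "r \<in> {od_option r k | r k.
        r \<in> ordered_part P \<and> 1 \<le> k \<and> k \<le> od_size r \<and> sat I (od_option r k)}"
      then show ?thesis using all c_red J unfolding \<Pi>_def by blast
    next
      assume "r \<in> {od_constraint r | r. r \<in> ordered_part P \<and> sat I (od_constraint r)}"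
      \<comment> \<open>The head is empty, so the body fails in \<open>I\<close>; a positive body
        failing in \<open>I\<close> also fails in \<open>J\<close>.\<close>
      then show ?thesis using J unfolding sat_def reduct_sat_def od_constraint_def by auto
    qed
    then show False using st J unfolding stable_model_iff by blast
  qed
  ultimately have "stable_model \<Pi> I"
    using st unfolding stable_model_iff by blast
  moreover have "split_program P \<Pi>"
    using c unfolding split_program_def \<Pi>_def by blast
  ultimately show "I \<in> CSM P" unfolding CSM_def by blast
qed

lemma CSM_eq_SSM: "lpod_program P \<Longrightarrow> CSM P = SSM (tau_times P)"
  using CSM_subset_SSM SSM_subset_CSM by blast

section \<open>Passing contexts between the two formalisms\<close>

text \<open>Semi-strong equivalence ranges over finite contexts; this admits the translation of an
  LPOD context among them.\<close>

lemma lpmln_program_tau_times: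
  assumes "lpod_program P"
  shows "lpmln_program (tau_times P)"
proof -
  have fin: "finite (regular_part P)" "finite (ordered_part P)"
    using assms finite_vimageI[of P Regular] finite_vimageI[of P Ordered]
    unfolding lpod_program_def regular_part_def ordered_part_def vimage_def
    by (auto simp: inj_def)
  have "{(Soft 1, od_option r k) | r k. r \<in> ordered_part P \<and> 1 \<le> k \<and> k \<le> od_size r} =
      (\<Union>r\<in>ordered_part P. (\<lambda>k. (Soft 1, od_option r k)) ` {1..od_size r})"
    by fastforce
  then show ?thesis
    using fin unfolding lpmln_program_def tau_times_def by simp
qed

text \<open>Stability of \<open>I\<close> depends only on the rules that \<open>I\<close> satisfies,
  whatever their weights, and making these hard adds no demand on \<open>I\<close>. The last
  conjunct accounts for hard rules of \<open>R\<close> violated by \<open>I\<close>, which the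
  replacement drops.\<close>

lemma SSM_Un_satisfied_iff:
  "I \<in> SSM (P \<union> R) \<longleftrightarrow>
     I \<in> SSM (P \<union> {Hard} \<times> unweighted (satisfied_part R I)) \<and>
     models I (unweighted (hard_part R))"
proof -
  let ?\<Pi> = "unweighted (satisfied_part R I)"
  have "unweighted (satisfied_part ({Hard} \<times> ?\<Pi>) I) = ?\<Pi>"
    unfolding unweighted_def satisfied_part_def by auto
  moreover have "unweighted (hard_part ({Hard} \<times> ?\<Pi>)) = ?\<Pi>"
    unfolding unweighted_def hard_part_def by auto
  ultimately show ?thesis
    using models_satisfied_part[of I R]
    by (auto simp: SSM_def lpmln_stable_model_def unweighted_Un satisfied_part_Un hard_part_Un
        models_Un)
qed

lemma finite_unweighted_satisfied:
  assumes "lpmln_program R"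
  shows "finite (unweighted (satisfied_part R I))"
proof (rule finite_subset)
  show "unweighted (satisfied_part R I) \<subseteq> snd ` R"
    unfolding unweighted_def satisfied_part_def by force
  show "finite (snd ` R)" using assms unfolding lpmln_program_def by simp
qed

theorem theorem6p10:
  fixes P Q :: "'a lpod_rule set"
  assumes "lpod_program P" and "lpod_program Q"
  shows "lpod_strongly_equivalent P Q \<longleftrightarrow>
         soft_semi_strongly_equivalent (tau_times P) (tau_times Q)"
proof
  assume equiv: "lpod_strongly_equivalent P Q"
  have "I \<in> SSM (tau_times P \<union> R) \<longleftrightarrow> I \<in> SSM (tau_times Q \<union> R)"
    if R: "lpmln_program R" for R :: "'a lpmln" and I
  proof -
    \<comment> \<open>This context depends on \<open>I\<close>, so the two sets are compared one
      interpretation at a time.\<close>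
    let ?R = "Regular ` unweighted (satisfied_part R I)"
    have prog: "lpod_program ?R"
      using R by (intro lpod_program_Regular finite_unweighted_satisfied)
    then have "SSM (tau_times P \<union> tau_times ?R) = SSM (tau_times Q \<union> tau_times ?R)"
      using equiv assms unfolding lpod_strongly_equivalent_def
      by (metis CSM_eq_SSM lpod_program_Un tau_times_Un)
    then show ?thesis
      unfolding tau_times_Regular
      by (simp add: SSM_Un_satisfied_iff[of I "tau_times P" R]
          SSM_Un_satisfied_iff[of I "tau_times Q" R])
  qed
  then show "soft_semi_strongly_equivalent (tau_times P) (tau_times Q)"
    unfolding soft_semi_strongly_equivalent_def by blast
next
  assume equiv: "soft_semi_strongly_equivalent (tau_times P) (tau_times Q)"
  show "lpod_strongly_equivalent P Q"
    unfolding lpod_strongly_equivalent_def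
  proof (intro allI impI)
    fix R :: "'a lpod_rule set"
    assume R: "lpod_program R"
    then have "SSM (tau_times P \<union> tau_times R) = SSM (tau_times Q \<union> tau_times R)"
      using equiv lpmln_program_tau_times unfolding soft_semi_strongly_equivalent_def by blast
    then show "CSM (P \<union> R) = CSM (Q \<union> R)"
      using assms R by (simp add: CSM_eq_SSM lpod_program_Un tau_times_Un)
  qed
qed

end
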